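(* Let $n\in\{2,3\}$, let $p$ be a pressure law as in the context, and let $\mathcal{K}_0\in\mathbb{R}$ be a constant. For $\delta\in\mathbb{R}$ define $$\mathcal{P}_\delta:=\{(z,\mathbf{q})\in\mathbb{R}\times\mathbb{R}^n:\ p'(\rho(z,\mathbf{q}))-|\mathbf{q}|^2\ge\delta\},$$ where $\rho(z,\mathbf{q})=i^{-1}\big(\mathcal{K}_0+z-\tfrac12|\mathbf{q}|^2\big)$, and only points $(z,\mathbf{q})$ for which $\mathcal{K}_0+z-\tfrac12|\mathbf{q}|^2$ lies in the range $\{i(\rho):0<\rho<\infty\}$ are considered. If $$\frac{d}{d\rho}\left(\frac{\rho\,p''(\rho)}{p'(\rho)}\right)\le0\quad\text{for all }\rho>0,$$ then the set $\mathcal{P}_\delta$ is convex for any $\delta>0$.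
   Context: The pressure law $p\in C^0([0,\infty))\cap C^\infty((0,\infty))$ satisfies $p(0)=0$, $\lim_{\rho\to\infty}p(\rho)=\infty$, and $p'(\rho)>0$, $p''(\rho)\ge0$ for all $\rho>0$. The enthalpy is $i(\rho)=\int_1^\rho\frac{p'(\varrho)}{\varrho}\,d\varrho$ for $\rho>0$; it is strictly increasing, hence invertible from $(0,\infty)$ onto its range. *)

theory Defs
  imports "HOL-Analysis.Analysis"
begin

(* Meant for open S, so that the iterated derivatives depend only on the values of f on S. *)
definition C_infinity_on :: "real set \<Rightarrow> (real \<Rightarrow> real) \<Rightarrow> bool" where
  "C_infinity_on S f \<longleftrightarrow> (\<forall>k. \<forall>x\<in>S. (deriv ^^ k) f differentiable (at x))"

(* A pressure law is a function on [0, \<infinity>); the values of p at negative arguments are unconstrained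
   and play no role. *)
definition pressure_law :: "(real \<Rightarrow> real) \<Rightarrow> bool" where
  "pressure_law p \<longleftrightarrow>
     continuous_on {0..} p \<and> C_infinity_on {0<..} p \<and>
     p 0 = 0 \<and> filterlim p at_top at_top \<and>
     (\<forall>\<rho>>0. deriv p \<rho> > 0) \<and> (\<forall>\<rho>>0. deriv (deriv p) \<rho> \<ge> 0)"

(* The interval integral is oriented: for \<rho> < 1 it is minus the integral over [\<rho>, 1]. *)
definition enthalpy :: "(real \<Rightarrow> real) \<Rightarrow> real \<Rightarrow> real" where
  "enthalpy p \<rho> = (LBINT r=1..\<rho>. deriv p r / r)"

definition enthalpy_inv :: "(real \<Rightarrow> real) \<Rightarrow> real \<Rightarrow> real" where
  "enthalpy_inv p = inv_into {0<..} (enthalpy p)"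

definition rho_of :: "(real \<Rightarrow> real) \<Rightarrow> real \<Rightarrow> real \<Rightarrow> (real ^ 'n) \<Rightarrow> real" where
  "rho_of p K0 z q = enthalpy_inv p (K0 + z - (norm q)\<^sup>2 / 2)"

definition P_set :: "(real \<Rightarrow> real) \<Rightarrow> real \<Rightarrow> real \<Rightarrow> (real \<times> (real ^ 'n)) set" where
  "P_set p K0 \<delta> = {(z, q).
     K0 + z - (norm q)\<^sup>2 / 2 \<in> enthalpy p ` {0<..} \<and>
     deriv p (rho_of p K0 z q) - (norm q)\<^sup>2 \<ge> \<delta>}"

end

theory Submission
  imports Defs
begin

text \<open>
  Put \<open>h \<rho> = \<rho> p''(\<rho>) / p'(\<rho>)\<close>. Regarded as a function of the enthalpy \<open>s = i(\<rho>)\<close>, the squared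
  sound speed \<open>p'(\<rho>)\<close> has derivative \<open>h \<rho>\<close>, which is nonnegative and, by hypothesis, nonincreasing.
  So it is a nondecreasing concave function of \<open>s\<close>, and \<open>K0 + z - |q|\<^sup>2 / 2\<close> is concave in \<open>(z, q)\<close>;
  hence \<open>p'(\<rho>(z, q)) - |q|\<^sup>2\<close> is concave. Its domain is convex because \<open>p'' \<ge> 0\<close> forces
  \<open>i(\<rho>) \<ge> p'(1) ln \<rho>\<close> for \<open>\<rho> \<ge> 1\<close>, so that the range of \<open>i\<close> is unbounded above.
  Concavity is used as a tangent line inequality in \<open>\<rho>\<close>, which avoids differentiating \<open>i\<^sup>-\<^sup>1\<close>.
\<close>

lemma C_infinity_on_DERIV:
  assumes "C_infinity_on S f" "x \<in> S"
  shows "((deriv ^^ k) f has_real_derivative deriv ((deriv ^^ k) f) x) (at x)"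
  using assms DERIV_deriv_iff_real_differentiable unfolding C_infinity_on_def by blast

lemma pressure_law_DERIV:
  assumes "pressure_law p" "x > 0"
  shows "(deriv p has_real_derivative deriv (deriv p) x) (at x)"
    and "(deriv (deriv p) has_real_derivative deriv (deriv (deriv p)) x) (at x)"
  using C_infinity_on_DERIV[of "{0<..}" p x 1] C_infinity_on_DERIV[of "{0<..}" p x 2] assms
  by (auto simp: pressure_law_def numeral_2_eq_2)

lemma pressure_law_deriv_pos: "pressure_law p \<Longrightarrow> x > 0 \<Longrightarrow> deriv p x > 0"
  by (simp add: pressure_law_def)

lemma pressure_law_deriv_mono:
  assumes "pressure_law p" "0 < a" "a \<le> b"
  shows "deriv p a \<le> deriv p b"
proof (rule DERIV_nonneg_imp_nondecreasing[OF assms(3)])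
  fix x assume "a \<le> x" "x \<le> b"
  then show "\<exists>y. DERIV (deriv p) x :> y \<and> 0 \<le> y"
    using assms pressure_law_DERIV(1)[OF assms(1), of x]
    by (intro exI[of _ "deriv (deriv p) x"]) (simp add: pressure_law_def)
qed

lemma enthalpy_DERIV:
  assumes p: "pressure_law p" and x: "x > 0"
  shows "(enthalpy p has_real_derivative deriv p x / x) (at x)"
proof -
  define a b where "a = min x 1 / 2" and "b = max x 1 + 1"
  have ab: "0 < a" "a < x" "x < b" "a \<le> 1" "1 \<le> b"
    using x by (auto simp: a_def b_def)
  have "isCont (deriv p) r" if "r \<in> {a..b}" for r
    using that ab pressure_law_DERIV(1)[OF p, of r] DERIV_isCont by force
  then have "continuous_on {a..b} (\<lambda>r. deriv p r / r)"
    using ab by (intro continuous_intros continuous_at_imp_continuous_on) auto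
  then have "((\<lambda>u. LBINT r=ereal 1..u. deriv p r / r) has_vector_derivative deriv p x / x)
      (at x within {a..b})"
    using ab by (intro interval_integral_FTC2) auto
  moreover have "at x within {a..b} = at x"
    using ab by (intro at_within_interior) simp
  ultimately show ?thesis
    by (simp add: has_real_derivative_iff_has_vector_derivative enthalpy_def[abs_def]
        one_ereal_def)
qed

lemma enthalpy_ge_ln:
  assumes p: "pressure_law p" and x: "x \<ge> 1"
  shows "deriv p 1 * ln x \<le> enthalpy p x"
proof -
  have "enthalpy p 1 - deriv p 1 * ln 1 \<le> enthalpy p x - deriv p 1 * ln x"
  proof (rule DERIV_nonneg_imp_nondecreasing[OF x])
    fix t :: real assume t: "1 \<le> t" "t \<le> x"
    have "((\<lambda>t. enthalpy p t - deriv p 1 * ln t) has_real_derivative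
        deriv p t / t - deriv p 1 * (1 / t)) (at t)"
      using t by (intro DERIV_diff DERIV_cmult DERIV_ln_divide enthalpy_DERIV[OF p]) auto
    moreover have "0 \<le> deriv p t / t - deriv p 1 * (1 / t)"
      using t pressure_law_deriv_mono[OF p, of 1 t] by (simp add: divide_right_mono)
    ultimately show "\<exists>y. DERIV (\<lambda>t. enthalpy p t - deriv p 1 * ln t) t :> y \<and> 0 \<le> y"
      by blast
  qed
  then show ?thesis by (simp add: enthalpy_def one_ereal_def)
qed

text \<open>The logarithmic lower bound provides a point where the enthalpy exceeds
  \<open>t\<close>, and the intermediate value theorem does the rest.\<close>

lemma enthalpy_range_upward_closed:
  assumes p: "pressure_law p" and s: "s \<in> enthalpy p ` {0<..}" and st: "s \<le> t"
  shows "t \<in> enthalpy p ` {0<..}"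
proof -
  obtain x where x: "x > 0" "s = enthalpy p x" using s by auto
  have c: "deriv p 1 > 0" using pressure_law_deriv_pos[OF p] by simp
  \<comment> \<open>The exponential makes \<open>deriv p 1 * ln y\<close> at least \<open>t\<close>;
    the maxima with 1 and \<open>x\<close> allow the logarithmic bound and put \<open>y\<close> to
    the right of \<open>x\<close>.\<close>
  define y where "y = max (max x 1) (exp (t / deriv p 1))"
  have y: "y \<ge> 1" "x \<le> y" by (auto simp: y_def)
  have "t / deriv p 1 = ln (exp (t / deriv p 1))" by simp
  also have "\<dots> \<le> ln y" by (subst ln_le_cancel_iff) (auto simp: y_def)
  finally have "t \<le> deriv p 1 * ln y" using c by (simp add: field_simps)
  also have "\<dots> \<le> enthalpy p y" by (rule enthalpy_ge_ln[OF p y(1)])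
  finally have "t \<le> enthalpy p y" .
  moreover have "continuous_on {x..y} (enthalpy p)"
    using x by (intro continuous_at_imp_continuous_on) (auto intro!: DERIV_isCont enthalpy_DERIV[OF p])
  ultimately obtain r where "x \<le> r" "enthalpy p r = t"
    using IVT'[of "enthalpy p" x t y] st x y by auto
  then show ?thesis using x by force
qed

text \<open>With \<open>h\<close> the slope of \<open>deriv p\<close> against the enthalpy,
  \<open>g = deriv p - h a * enthalpy p\<close> has a derivative of the sign of
  \<open>h r - h a\<close>. As \<open>h\<close> is nonincreasing, \<open>g\<close> rises before
  \<open>a\<close> and falls after it, so it is maximal at \<open>a\<close>.\<close>

lemma deriv_le_enthalpy_tangent:
  assumes p: "pressure_law p" and a: "a > 0" and b: "b > 0"
    and dec: "\<forall>\<rho>>0. deriv (\<lambda>r. r * deriv (deriv p) r / deriv p r) \<rho> \<le> 0"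
  shows "deriv p b \<le> deriv p a + a * deriv (deriv p) a / deriv p a * (enthalpy p b - enthalpy p a)"
proof -
  define h where "h r = r * deriv (deriv p) r / deriv p r" for r
  have anti: "h y \<le> h x" if "0 < x" "x \<le> y" for x y
  proof (rule DERIV_nonpos_imp_nonincreasing[OF that(2)])
    fix r assume "x \<le> r" "r \<le> y"
    then have r: "r > 0" using that by simp
    \<comment> \<open>A bound on \<open>deriv\<close> says something about monotonicity only where
      \<open>h\<close> is differentiable; smoothness and positivity of \<open>deriv p\<close> ensure
      this.\<close>
    have "h differentiable (at r)"
      unfolding h_def using r pressure_law_DERIV[OF p r] pressure_law_deriv_pos[OF p r]
      by (intro derivative_intros) (auto simp: real_differentiable_def)
    then show "\<exists>d. DERIV h r :> d \<and> d \<le> 0"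
      using dec r by (auto simp: h_def[abs_def] DERIV_deriv_iff_real_differentiable[symmetric])
  qed
  define g where "g r = deriv p r - h a * enthalpy p r" for r
  have g': "(g has_real_derivative deriv p r / r * (h r - h a)) (at r)" if "r > 0" for r
  proof -
    have "(g has_real_derivative deriv (deriv p) r - h a * (deriv p r / r)) (at r)"
      unfolding g_def
      using that by (intro DERIV_diff DERIV_cmult enthalpy_DERIV[OF p] pressure_law_DERIV[OF p])
    moreover have "deriv (deriv p) r - h a * (deriv p r / r) = deriv p r / r * (h r - h a)"
      using that pressure_law_deriv_pos[OF p that] by (simp add: h_def[of r] field_simps)
    ultimately show ?thesis by simp
  qed
  have pos: "deriv p r / r \<ge> 0" if "r > 0" for r
    using that pressure_law_deriv_pos[OF p that] by simp
  have "g b \<le> g a"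
  proof (cases "a \<le> b")
    case True
    then show ?thesis
    proof (rule DERIV_nonpos_imp_nonincreasing)
      fix r assume "a \<le> r" "r \<le> b"
      then show "\<exists>d. DERIV g r :> d \<and> d \<le> 0"
        using a g'[of r] pos[of r] anti[of a r]
        by (intro exI[of _ "deriv p r / r * (h r - h a)"] conjI mult_nonneg_nonpos) auto
    qed
  next
    case False
    then have "b \<le> a" by simp
    then show ?thesis
    proof (rule DERIV_nonneg_imp_nondecreasing)
      fix r assume "b \<le> r" "r \<le> a"
      then show "\<exists>d. DERIV g r :> d \<and> 0 \<le> d"
        using b g'[of r] pos[of r] anti[of r a]
        by (intro exI[of _ "deriv p r / r * (h r - h a)"] conjI mult_nonneg_nonneg) auto
    qed
  qed
  then show ?thesis by (simp add: g_def algebra_simps flip: h_def)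
qed

lemma norm_square_convex_comb:
  fixes x y :: "'a :: real_inner"
  assumes "u \<ge> 0" "v \<ge> 0" "u + v = 1"
  shows "(norm (u *\<^sub>R x + v *\<^sub>R y))\<^sup>2 \<le> u * (norm x)\<^sup>2 + v * (norm y)\<^sup>2"
proof -
  have v: "v = 1 - u" using assms by simp
  \<comment> \<open>The convexity gap of the squared norm is computed exactly.\<close>
  have "u * (norm x)\<^sup>2 + v * (norm y)\<^sup>2 - (norm (u *\<^sub>R x + v *\<^sub>R y))\<^sup>2 = u * v * (norm (x - y))\<^sup>2"
    unfolding v power2_norm_eq_inner
    by (simp add: inner_add_left inner_add_right inner_diff_left inner_diff_right
        inner_commute[of y x] algebra_simps power2_eq_square)
  then show ?thesis using assms by (smt (verit) mult_nonneg_nonneg zero_le_power2)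
qed

lemma enthalpy_inv:
  assumes "s \<in> enthalpy p ` {0<..}"
  shows "enthalpy_inv p s > 0" "enthalpy p (enthalpy_inv p s) = s"
  using inv_into_into[OF assms] f_inv_into_f[OF assms] by (auto simp: enthalpy_inv_def)

lemma convex_P_set:
  assumes p: "pressure_law p"
    and dec: "\<forall>\<rho>>0. deriv (\<lambda>r. r * deriv (deriv p) r / deriv p r) \<rho> \<le> 0"
  shows "convex (P_set p K0 \<delta> :: (real \<times> (real ^ 'n)) set)"
proof (rule convexI)
  fix x y :: "real \<times> (real ^ 'n)" and u v :: real
  assume x: "x \<in> P_set p K0 \<delta>" and y: "y \<in> P_set p K0 \<delta>" and uv: "0 \<le> u" "0 \<le> v" "u + v = 1"
  define s :: "real \<times> (real ^ 'n) \<Rightarrow> real" where "s w = K0 + fst w - (norm (snd w))\<^sup>2 / 2" for w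
  define R where "R w = enthalpy_inv p (s w)" for w
  have P_iff: "w \<in> P_set p K0 \<delta> \<longleftrightarrow>
      s w \<in> enthalpy p ` {0<..} \<and> deriv p (R w) - (norm (snd w))\<^sup>2 \<ge> \<delta>" for w
    by (cases w) (simp add: P_set_def rho_of_def s_def R_def)
  define w where "w = u *\<^sub>R x + v *\<^sub>R y"
  have nw: "(norm (snd w))\<^sup>2 \<le> u * (norm (snd x))\<^sup>2 + v * (norm (snd y))\<^sup>2"
    unfolding w_def using norm_square_convex_comb[OF uv] by simp
  have "u * K0 + v * K0 = K0" using uv(3) by (metis distrib_right mult_1)
  then have sw: "u * s x + v * s y \<le> s w"
    using nw by (simp add: s_def w_def algebra_simps)
  \<comment> \<open>\<open>convex_bound_le\<close> gives upper bounds, hence the negated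
    values.\<close>
  have "min (s x) (s y) \<le> s w"
    using convex_bound_le[of "- s x" "- min (s x) (s y)" "- s y" u v] uv sw by auto
  moreover have "min (s x) (s y) \<in> enthalpy p ` {0<..}"
    using x y by (simp add: P_iff min_def)
  ultimately have w_range: "s w \<in> enthalpy p ` {0<..}"
    using enthalpy_range_upward_closed[OF p] by blast
  \<comment> \<open>The tangent is taken at the convex combination \<open>w\<close> itself, and the
    inequality is then applied at both endpoints with the same slope \<open>m\<close>.\<close>
  define a where "a = R w"
  define m where "m = a * deriv (deriv p) a / deriv p a"
  have a: "a > 0" "enthalpy p a = s w"
    using enthalpy_inv[OF w_range] by (auto simp: a_def R_def)
  \<comment> \<open>Here p'' \<ge> 0 enters: \<open>sw\<close> is only an inequality, so the last
    estimate of the chain below needs a nonnegative slope.\<close>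
  have m: "m \<ge> 0"
    using a p by (auto simp: m_def pressure_law_def intro!: divide_nonneg_pos mult_nonneg_nonneg)
  have tangent: "deriv p (R t) \<le> deriv p a + m * (s t - s w)" if "t \<in> P_set p K0 \<delta>" for t
  proof -
    have "s t \<in> enthalpy p ` {0<..}" using that by (simp add: P_iff)
    from enthalpy_inv[OF this] show ?thesis
      using deriv_le_enthalpy_tangent[OF p a(1) _ dec, of "R t"] a by (simp add: R_def m_def)
  qed
  have bound: "\<delta> + (norm (snd t))\<^sup>2 \<le> deriv p a + m * (s t - s w)" if "t \<in> P_set p K0 \<delta>" for t
    using tangent[OF that] that by (simp add: P_iff)
  have v: "v = 1 - u" using uv by simp
  have "\<delta> + (norm (snd w))\<^sup>2 \<le> u * (\<delta> + (norm (snd x))\<^sup>2) + v * (\<delta> + (norm (snd y))\<^sup>2)"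
    using nw by (simp add: v algebra_simps)
  also have "\<dots> \<le> u * (deriv p a + m * (s x - s w)) + v * (deriv p a + m * (s y - s w))"
    by (intro add_mono[OF mult_left_mono mult_left_mono] bound x y uv)
  also have "\<dots> = deriv p a + m * (u * s x + v * s y - s w)"
    by (simp add: v algebra_simps)
  also have "\<dots> \<le> deriv p a"
    using m sw by (simp add: mult_nonneg_nonpos)
  finally show "u *\<^sub>R x + v *\<^sub>R y \<in> P_set p K0 \<delta>"
    using w_range by (simp add: P_iff a_def flip: w_def)
qed

theorem proposition6:
  fixes p :: "real \<Rightarrow> real" and K0 :: real
  assumes "CARD('n::finite) \<in> {2, 3}"
    and "pressure_law p"
    and "\<forall>\<rho>>0. deriv (\<lambda>r. r * deriv (deriv p) r / deriv p r) \<rho> \<le> 0"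
  shows "\<forall>\<delta>>0. convex (P_set p K0 \<delta> :: (real \<times> (real ^ 'n)) set)"
  using convex_P_set[OF assms(2,3)] by blast

end
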